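(* Let $\mathbb{K}$ be a field, $\rho:\mathbb{N}^+\to\mathbb{K}$ any function, and $f(x)\in\mathbb{K}[[x]]$ with $$\sum_{n\ge 1}\Big(\sum_{T\in PT(n)}\prod_{h\in\mathcal{H}(T)}\rho(h)\Big)x^n=f(x).$$ Then for every $n\ge1$ with $[x^{n-1}]\frac{1}{1-f(x)}\neq 0$, $$\rho(n)=\frac{[x^n]f(x)}{[x^{n-1}]\frac{1}{1-f(x)}}.$$
   Context: A plane tree is a rooted unlabeled tree in which the (nonempty) subtrees of each vertex are arranged in linear order; $PT(n)$ denotes the set of plane trees with $n$ vertices. For a vertex $u$ of a tree $T$, the hook length $h_u$ is the number of descendants of $u$ (counting $u$ itself), and $\mathcal{H}(T)$ is the multiset of hook lengths of the vertices; the product over $\mathcal{H}(T)$ is the product over all vertices. $[x^n]g(x)$ is the coefficient of $x^n$ in $g(x)$. *)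

theory Defs
  imports
    "HOL-Library.Multiset"
    "HOL-Library.Sublist"
    "HOL-Computational_Algebra.Formal_Power_Series"
begin

text \<open>
  The type has no label and no empty tree, and the order of the list is the linear order
  of the subtrees. Thus two values are equal iff they are isomorphic as plane trees.
\<close>

datatype plane_tree = Node (subtrees: "plane_tree list")

text \<open>
  A vertex is represented by its address, the sequence of child positions (counted from 0) on
  the path from the root to it. Hence the descendants of a vertex \<open>u\<close>, including \<open>u\<close>, are
  the vertices of which \<open>u\<close> is a prefix.
\<close>

fun is_vertex :: "plane_tree \<Rightarrow> nat list \<Rightarrow> bool" where
  "is_vertex T [] \<longleftrightarrow> True"
| "is_vertex T (i # p) \<longleftrightarrow> i < length (subtrees T) \<and> is_vertex (subtrees T ! i) p"

definition vertices :: "plane_tree \<Rightarrow> nat list set" where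
  "vertices T = {u. is_vertex T u}"

definition descendants :: "plane_tree \<Rightarrow> nat list \<Rightarrow> nat list set" where
  "descendants T u = {v \<in> vertices T. prefix u v}"

definition hook_length :: "plane_tree \<Rightarrow> nat list \<Rightarrow> nat" where
  "hook_length T u = card (descendants T u)"

definition hook_lengths :: "plane_tree \<Rightarrow> nat multiset" where
  "hook_lengths T = image_mset (hook_length T) (mset_set (vertices T))"

definition PT :: "nat \<Rightarrow> plane_tree set" where
  "PT n = {T. card (vertices T) = n}"

text \<open>
  \<open>card\<close>, \<open>mset_set\<close> and \<open>sum\<close> return a default value on infinite sets; the next facts show that
  this never happens here, and that \<open>0\<close> is never a hook length.
\<close>

lemma vertices_Node:
  "vertices (Node ts) = insert [] (\<Union>i<length ts. (#) i ` vertices (ts ! i))"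
proof (rule set_eqI)
  fix u
  show "u \<in> vertices (Node ts) \<longleftrightarrow> u \<in> insert [] (\<Union>i<length ts. (#) i ` vertices (ts ! i))"
    by (cases u) (auto simp: vertices_def)
qed

lemma finite_vertices: "finite (vertices T)"
  by (induction T) (auto simp: vertices_Node)

lemma zero_not_in_hook_lengths: "0 \<notin># hook_lengths T"
proof
  assume "0 \<in># hook_lengths T"
  then obtain u where "u \<in> vertices T" "card (descendants T u) = 0"
    by (auto simp: hook_lengths_def hook_length_def finite_vertices)
  moreover have "finite (descendants T u)"
    by (simp add: descendants_def finite_vertices)
  ultimately show False
    by (auto simp: descendants_def)
qed

lemma card_vertices_Node:
  "card (vertices (Node ts)) = Suc (\<Sum>t\<leftarrow>ts. card (vertices t))"
proof -
  have "card (\<Union>i<length ts. (#) i ` vertices (ts ! i))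
      = (\<Sum>i<length ts. card ((#) i ` vertices (ts ! i)))"
    by (rule card_UN_disjoint) (auto simp: finite_vertices)
  also have "\<dots> = (\<Sum>i<length ts. card (vertices (ts ! i)))"
    by (intro sum.cong refl card_image) (simp add: inj_on_def)
  also have "\<dots> = (\<Sum>t\<leftarrow>ts. card (vertices t))"
    by (simp add: sum_list_sum_nth atLeast0LessThan)
  finally show ?thesis
    unfolding vertices_Node
    by (subst card_insert_disjoint) (auto simp: finite_vertices)
qed

lemma card_vertices_pos: "card (vertices T) > 0"
  by (cases T) (simp add: card_vertices_Node)

lemma finite_PT: "finite (PT n)"
proof (induction n rule: less_induct)
  case (less n)
  let ?S = "\<Union>m<n. PT m"
  have "PT n \<subseteq> Node ` {ts. set ts \<subseteq> ?S \<and> length ts \<le> n}"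
  proof
    fix T assume T: "T \<in> PT n"
    obtain ts where ts: "T = Node ts" by (cases T)
    have eq: "Suc (\<Sum>t\<leftarrow>ts. card (vertices t)) = n"
      using T by (simp add: ts PT_def card_vertices_Node)
    have "card (vertices t) < n" if "t \<in> set ts" for t
      using member_le_sum_list[of "card (vertices t)" "map (\<lambda>t. card (vertices t)) ts"] that eq
      by auto
    moreover have "length ts \<le> (\<Sum>t\<leftarrow>ts. card (vertices t))"
    proof (induction ts)
      case (Cons t ts)
      then show ?case using card_vertices_pos[of t] by simp
    qed simp
    ultimately have "set ts \<subseteq> ?S \<and> length ts \<le> n"
      using eq by (auto simp: PT_def)
    then show "T \<in> Node ` {ts. set ts \<subseteq> ?S \<and> length ts \<le> n}"
      unfolding ts by blast
  qed
  moreover have "finite {ts. set ts \<subseteq> ?S \<and> length ts \<le> n}"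
    using less by (intro finite_lists_length_le) auto
  ultimately show ?case
    by (meson finite_imageI finite_subset)
qed

end

theory Submission
  imports Defs
begin

text \<open>
  Deleting the root of a tree with \<open>n\<close> vertices leaves an ordered forest with \<open>n - 1\<close> vertices,
  and it keeps all hook lengths except the one of the root, which is \<open>n\<close>. So \<open>[x^n] f\<close> is
  \<open>\<rho> n\<close> times the total weight of the forests with \<open>n - 1\<close> vertices. A nonempty forest is a first
  tree followed by a forest, hence the generating function \<open>G\<close> of the forests satisfies
  \<open>G = 1 + f * G\<close>, i.e. \<open>G = 1 / (1 - f)\<close>.
\<close>

lemma descendants_Cons:
  assumes "i < length ts"
  shows "descendants (Node ts) (i # u) = (#) i ` descendants (ts ! i) u"
  using assms by (auto simp: descendants_def vertices_Node)

lemma hook_length_Cons: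
  assumes "i < length ts"
  shows "hook_length (Node ts) (i # u) = hook_length (ts ! i) u"
  using assms by (simp add: hook_length_def descendants_Cons card_image)

lemma hook_length_root: "hook_length T [] = card (vertices T)"
  by (simp add: hook_length_def descendants_def)

definition hook_weight :: "(nat \<Rightarrow> 'a::comm_monoid_mult) \<Rightarrow> plane_tree \<Rightarrow> 'a" where
  "hook_weight \<rho> T = (\<Prod>h\<in>#hook_lengths T. \<rho> h)"

text \<open>As a product over a set of addresses, the weight can be split along disjoint unions and
  reindexed.\<close>

lemma hook_weight_altdef: "hook_weight \<rho> T = (\<Prod>u\<in>vertices T. \<rho> (hook_length T u))"
  by (simp add: hook_weight_def hook_lengths_def prod_unfold_prod_mset multiset.map_comp comp_def)

text \<open>The addresses split into the root and, for each \<open>i\<close>, those that start with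
  \<open>i\<close>. By \<open>hook_length_Cons\<close> the latter contribute exactly the weight of
  the subtree \<open>ts ! i\<close>.\<close>

lemma hook_weight_Node:
  "hook_weight \<rho> (Node ts) = \<rho> (card (vertices (Node ts))) * (\<Prod>t\<leftarrow>ts. hook_weight \<rho> t)"
proof -
  let ?w = "\<lambda>u. \<rho> (hook_length (Node ts) u)"
  have "(\<Prod>u\<in>(\<Union>i<length ts. (#) i ` vertices (ts ! i)). ?w u)
      = (\<Prod>i<length ts. \<Prod>u\<in>(#) i ` vertices (ts ! i). ?w u)"
    by (rule prod.UNION_disjoint) (auto simp: finite_vertices)
  also have "\<dots> = (\<Prod>i<length ts. hook_weight \<rho> (ts ! i))"
    by (intro prod.cong refl) (simp add: prod.reindex hook_length_Cons hook_weight_altdef)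
  also have "\<dots> = (\<Prod>t\<leftarrow>ts. hook_weight \<rho> t)"
    by (simp add: prod.list_conv_set_nth atLeast0LessThan)
  finally have "(\<Prod>u\<in>(\<Union>i<length ts. (#) i ` vertices (ts ! i)). ?w u)
      = (\<Prod>t\<leftarrow>ts. hook_weight \<rho> t)" .
  moreover have "hook_weight \<rho> (Node ts)
      = ?w [] * (\<Prod>u\<in>(\<Union>i<length ts. (#) i ` vertices (ts ! i)). ?w u)"
    unfolding hook_weight_altdef vertices_Node
    by (subst prod.insert) (auto simp: finite_vertices)
  ultimately show ?thesis
    by (simp add: hook_length_root)
qed

definition plane_forests :: "nat \<Rightarrow> plane_tree list set" where
  "plane_forests n = {ts. (\<Sum>t\<leftarrow>ts. card (vertices t)) = n}"

lemma PT_0: "PT 0 = {}"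
  using card_vertices_pos by (force simp: PT_def)

lemma PT_Suc: "PT (Suc n) = Node ` plane_forests n"
proof (rule set_eqI)
  fix T
  show "T \<in> PT (Suc n) \<longleftrightarrow> T \<in> Node ` plane_forests n"
    by (cases T) (auto simp: PT_def plane_forests_def card_vertices_Node)
qed

lemma finite_plane_forests: "finite (plane_forests n)"
  using finite_PT[of "Suc n"] by (simp add: PT_Suc finite_image_iff inj_on_def)

lemma plane_forests_0: "plane_forests 0 = {[]}"
proof -
  have "ts \<in> plane_forests 0 \<longleftrightarrow> ts = []" for ts
    using card_vertices_pos by (cases ts) (auto simp: plane_forests_def)
  then show ?thesis by blast
qed

text \<open>The index \<open>i\<close> is the size of the first tree. It starts at 0, although
  \<open>PT 0\<close> is empty, to match the range of the Cauchy product.\<close>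

lemma plane_forests_eq_Cons:
  assumes "n > 0"
  shows "plane_forests n
    = (\<lambda>(i, t, ts). t # ts) ` (SIGMA i:{0..n}. PT i \<times> plane_forests (n - i))" (is "_ = ?h ` ?S")
proof (rule set_eqI)
  fix us
  show "us \<in> plane_forests n \<longleftrightarrow> us \<in> ?h ` ?S"
  proof (cases us)
    case Nil
    then show ?thesis using assms by (auto simp: plane_forests_def)
  next
    case (Cons t ts)
    have "us \<in> plane_forests n \<longleftrightarrow> (card (vertices t), t, ts) \<in> ?S"
      by (auto simp: Cons plane_forests_def PT_def)
    also have "\<dots> \<longleftrightarrow> us \<in> ?h ` ?S"
      by (force simp: Cons PT_def)
    finally show ?thesis .
  qed
qed

lemma sum_plane_forests:
  fixes w :: "plane_tree \<Rightarrow> 'a::comm_semiring_1"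
  assumes "n > 0"
  shows "(\<Sum>ts\<in>plane_forests n. \<Prod>t\<leftarrow>ts. w t)
    = (\<Sum>i=0..n. (\<Sum>T\<in>PT i. w T) * (\<Sum>ts\<in>plane_forests (n - i). \<Prod>t\<leftarrow>ts. w t))"
proof -
  let ?S = "SIGMA i:{0..n}. PT i \<times> plane_forests (n - i)"
  have "inj_on (\<lambda>(i, t, ts). t # ts) ?S"
    \<comment> \<open>The component \<open>i\<close> is recovered from the list as the size of its
      head.\<close>
    by (auto simp: inj_on_def PT_def)
  then have "(\<Sum>ts\<in>plane_forests n. \<Prod>t\<leftarrow>ts. w t)
      = (\<Sum>(i, t, ts)\<in>?S. w t * (\<Prod>t\<leftarrow>ts. w t))"
    unfolding plane_forests_eq_Cons[OF assms]
    by (subst sum.reindex) (auto intro!: sum.cong)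
  also have "\<dots> = (\<Sum>i=0..n. \<Sum>(t, ts)\<in>PT i \<times> plane_forests (n - i). w t * (\<Prod>t\<leftarrow>ts. w t))"
    by (subst sum.Sigma) (auto simp: finite_PT finite_plane_forests intro!: sum.cong)
  also have "\<dots> = (\<Sum>i=0..n. (\<Sum>T\<in>PT i. w T) * (\<Sum>ts\<in>plane_forests (n - i). \<Prod>t\<leftarrow>ts. w t))"
    by (simp add: sum_product sum.cartesian_product)
  finally show ?thesis .
qed

lemma fps_plane_forests:
  fixes w :: "plane_tree \<Rightarrow> 'a::field"
  shows "Abs_fps (\<lambda>n. \<Sum>ts\<in>plane_forests n. \<Prod>t\<leftarrow>ts. w t)
    = 1 / (1 - Abs_fps (\<lambda>n. \<Sum>T\<in>PT n. w T))" (is "?G = 1 / (1 - ?f)")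
proof -
  have "?G = 1 + ?f * ?G"
  proof (rule fps_ext)
    fix n
    show "fps_nth ?G n = fps_nth (1 + ?f * ?G) n"
      \<comment> \<open>Coefficient 0 counts the empty forest, which is the summand 1; for positive
        \<open>n\<close>, \<open>sum_plane_forests\<close> is the Cauchy product.\<close>
      by (cases n) (simp_all add: plane_forests_0 PT_0 fps_mult_nth sum_plane_forests)
  qed
  then have "?G * (1 - ?f) = 1"
    by (simp add: algebra_simps)
  \<comment> \<open>No tree is empty, so \<open>?f\<close> has constant term 0 and
    \<open>1 - ?f\<close> is a unit; hence the division is multiplication by its inverse.\<close>
  moreover have "fps_nth (1 - ?f) 0 \<noteq> 0"
    by (simp add: PT_0)
  ultimately show ?thesis
    by (metis fps_divide_unit fps_inverse_unique mult.commute mult.left_neutral)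
qed

text \<open>\<open>Node\<close> maps the forests of size \<open>n\<close> bijectively onto the trees
  of size \<open>Suc n\<close>, and the root factor is the same for all of them.\<close>

lemma sum_hook_weight_PT_Suc:
  fixes \<rho> :: "nat \<Rightarrow> 'a::comm_semiring_1"
  shows "(\<Sum>T\<in>PT (Suc n). hook_weight \<rho> T)
    = \<rho> (Suc n) * (\<Sum>ts\<in>plane_forests n. \<Prod>t\<leftarrow>ts. hook_weight \<rho> t)"
proof -
  have "hook_weight \<rho> (Node ts) = \<rho> (Suc n) * (\<Prod>t\<leftarrow>ts. hook_weight \<rho> t)"
    if "ts \<in> plane_forests n" for ts
    using that by (simp add: hook_weight_Node card_vertices_Node plane_forests_def)
  then show ?thesis
    by (simp add: PT_Suc sum.reindex inj_on_def sum_distrib_left)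
qed

theorem theorem3p1:
  fixes \<rho> :: "nat \<Rightarrow> 'k::field"
    and f :: "'k fps"
    and n :: nat
  assumes "Abs_fps (\<lambda>m. if m \<ge> 1 then \<Sum>T\<in>PT m. \<Prod>h\<in>#hook_lengths T. \<rho> h else 0) = f"
    and "n \<ge> 1"
    and "fps_nth (1 / (1 - f)) (n - 1) \<noteq> 0"
  shows "\<rho> n = fps_nth f n / fps_nth (1 / (1 - f)) (n - 1)"
proof -
  obtain m where m: "n = Suc m"
    using assms(2) by (cases n) auto
  have f: "f = Abs_fps (\<lambda>m. \<Sum>T\<in>PT m. hook_weight \<rho> T)"
    \<comment> \<open>At index 0 the value 0 of the conditional agrees with the sum over the empty
      set \<open>PT 0\<close>.\<close>
    unfolding assms(1)[symmetric] by (rule fps_ext) (auto simp: hook_weight_def PT_0 not_less_eq_eq)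
  have "fps_nth f n = \<rho> n * fps_nth (1 / (1 - f)) m"
    unfolding f fps_plane_forests[symmetric] by (simp add: m sum_hook_weight_PT_Suc)
  then show ?thesis
    using assms(3) by (simp add: m)
qed

end
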